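(* Let $A$ be a complex square matrix that is congruent to a direct sum $\bigoplus_{\alpha\in\Gamma}M_\alpha$, where $\Gamma$ is a finite set and each $M_\alpha$ is a matrix of one of the six types $\mathcal{A}_{2r+1}$, $\mathcal{B}_{2r}(c)$, $\mathcal{C}_{2r+1}$, $\mathcal{D}_{2r}$, $\mathcal{E}_{2r}$, $\mathcal{F}_{2r}$. Then $\mathrm{Sol}_A$ is a group if and only if $\mathcal{A}_1$ is not one of the summands $M_\alpha$.
   Context: For $A\in M_n(\mathbb{C})$, $\mathrm{Sol}_A=\{X\in M_n(\mathbb{C}) : X^tAX=A\}$, a monoid under multiplication; "$\mathrm{Sol}_A$ is a group" means every element of it is invertible. $A$ is congruent to $B$ if $P^tAP=B$ for some invertible complex $P$. For $c\in\mathbb{C}$, let $J(c)$ be the $r\times r$ matrix with $J(c)_{i,r+1-i}=1$ ($1\le i\le r$), $J(c)_{i,r+2-i}=c$ ($2\le i\le r$), zeros elsewhere; let $I(c)$ be the $r\times r$ matrix with $I(c)_{i,r+1-i}=c$ ($1\le i\le r$), $I(c)_{i,r+2-i}=1$ ($2\le i\le r$), zeros elsewhere. The six types are: (a) $\mathcal{A}_1=(0)$ ($1\times1$), and for $r\ge1$, $\mathcal{A}_{2r+1}=\begin{pmatrix}0_{r+1}&P\\ Q&0_r\end{pmatrix}$ with $P$ of size $(r+1)\times r$, $P_{ii}=1$ for $1\le i\le r$, zeros elsewhere, and $Q$ of size $r\times(r+1)$, $Q_{i,i+1}=1$ for $1\le i\le r$, zeros elsewhere. (b) $\mathcal{B}_{2r}(c)=\begin{pmatrix}0_r&J(c)\\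 I(c)&0_r\end{pmatrix}$, $r\ge1$, $c\ne\pm1$. (c) $\mathcal{C}_{2r+1}$, $r\ge0$: the $(2r+1)\times(2r+1)$ matrix with $(i,2r+2-i)$ entry $1$ for all $i$, $(i,2r+3-i)$ entry $1$ for $2\le i\le r+1$ and $-1$ for $r+2\le i\le 2r+1$, zeros elsewhere. (d) $\mathcal{D}_{2r}=\begin{pmatrix}0_r&J(1)\\ J(-1)&0_r\end{pmatrix}$, $r\geq 1$ even. (e) $\mathcal{E}_{2r}$, $r\ge1$: the $2r\times2r$ matrix with $(i,2r+1-i)$ entry $1$ for $1\le i\le r$ and $-1$ for $r+1\le i\le2r$, $(i,2r+2-i)$ entry $1$ for $2\le i\le 2r$, zeros elsewhere. (f) $\mathcal{F}_{2r}=\begin{pmatrix}0_r&I(1)\\ I(-1)&0_r\end{pmatrix}$, $r\ge1$ odd. *)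

theory Defs
  imports Complex_Main "Jordan_Normal_Form.Matrix"
begin

definition Sol :: "complex mat \<Rightarrow> complex mat set" where
  "Sol A = {X \<in> carrier_mat (dim_row A) (dim_row A). transpose_mat X * A * X = A}"

text \<open>The monoid \<open>Sol A\<close> is a group precisely when each of its elements is an invertible matrix;
  this is the definition adopted (the inverse then lies in \<open>Sol A\<close> automatically).\<close>

definition Sol_is_group :: "complex mat \<Rightarrow> bool" where
  "Sol_is_group A \<longleftrightarrow> (\<forall>X \<in> Sol A. invertible_mat X)"

definition congruent_mat :: "complex mat \<Rightarrow> complex mat \<Rightarrow> bool" where
  "congruent_mat A B \<longleftrightarrow>
     (\<exists>P \<in> carrier_mat (dim_row A) (dim_row A). invertible_mat P \<and> transpose_mat P * A * P = B)"

text \<open>Row and column indices of matrices start at 0, so an entry in position \<open>(i, k - i)\<close> of the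
  usual 1-based numbering satisfies \<open>i + j = k - 2\<close> here. The usual side conditions \<open>i \<ge> 2\<close> on the
  lower antidiagonals are implied by \<open>j < n\<close>.\<close>

definition J_mat :: "nat \<Rightarrow> complex \<Rightarrow> complex mat" where
  "J_mat r c = mat r r (\<lambda>(i, j). if i + j + 1 = r then 1 else if i + j = r then c else 0)"

definition I_mat :: "nat \<Rightarrow> complex \<Rightarrow> complex mat" where
  "I_mat r c = mat r r (\<lambda>(i, j). if i + j + 1 = r then c else if i + j = r then 1 else 0)"

text \<open>In all six families the argument is \<open>r\<close>; the size of the matrix is \<open>2 * r + 1\<close> for types
  A and C, and \<open>2 * r\<close> for types B, D, E and F.\<close>

definition A_type :: "nat \<Rightarrow> complex mat" where
  "A_type r = four_block_mat
     (0\<^sub>m (r + 1) (r + 1)) (mat (r + 1) r (\<lambda>(i, j). if i = j then 1 else 0))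
     (mat r (r + 1) (\<lambda>(i, j). if j = i + 1 then 1 else 0)) (0\<^sub>m r r)"

lemma A_type_0: "A_type 0 = 0\<^sub>m 1 1"
  by (rule eq_matI) (auto simp: A_type_def)

definition B_type :: "nat \<Rightarrow> complex \<Rightarrow> complex mat" where
  "B_type r c = four_block_mat (0\<^sub>m r r) (J_mat r c) (I_mat r c) (0\<^sub>m r r)"

definition C_type :: "nat \<Rightarrow> complex mat" where
  "C_type r = mat (2 * r + 1) (2 * r + 1) (\<lambda>(i, j).
     if i + j = 2 * r then 1
     else if i + j = 2 * r + 1 then (if i \<le> r then 1 else -1)
     else 0)"

definition D_type :: "nat \<Rightarrow> complex mat" where
  "D_type r = four_block_mat (0\<^sub>m r r) (J_mat r 1) (J_mat r (-1)) (0\<^sub>m r r)"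

definition E_type :: "nat \<Rightarrow> complex mat" where
  "E_type r = mat (2 * r) (2 * r) (\<lambda>(i, j).
     if i + j + 1 = 2 * r then (if i < r then 1 else -1)
     else if i + j = 2 * r then 1
     else 0)"

definition F_type :: "nat \<Rightarrow> complex mat" where
  "F_type r = four_block_mat (0\<^sub>m r r) (I_mat r 1) (I_mat r (-1)) (0\<^sub>m r r)"

inductive canonical_block :: "complex mat \<Rightarrow> bool" where
  A: "canonical_block (A_type r)"
| B: "r \<ge> 1 \<Longrightarrow> c \<noteq> 1 \<Longrightarrow> c \<noteq> -1 \<Longrightarrow> canonical_block (B_type r c)"
| C: "canonical_block (C_type r)"
| D: "r \<ge> 1 \<Longrightarrow> even r \<Longrightarrow> canonical_block (D_type r)"
| E: "r \<ge> 1 \<Longrightarrow> canonical_block (E_type r)"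
| F: "r \<ge> 1 \<Longrightarrow> odd r \<Longrightarrow> canonical_block (F_type r)"

end

theory Submission
  imports Defs "Jordan_Normal_Form.Determinant"
begin

text \<open>Let \<open>K\<close> be the intersection of the kernels of \<open>A\<close> and \<open>A\<^sup>T\<close>. If \<open>X \<in> Sol A\<close> and \<open>X v = 0\<close>, then
  \<open>X\<^sup>T A X = A\<close> and its transpose give \<open>v \<in> K\<close>. Conversely, if \<open>v \<in> K\<close> and \<open>v\<^sub>k \<noteq> 0\<close>, then subtracting
  \<open>v / v\<^sub>k\<close> from the \<open>k\<close>-th column of the identity gives a singular element of \<open>Sol A\<close>. So \<open>Sol A\<close> is a
  group iff \<open>K = 0\<close>. This condition is invariant under congruence and can be checked block by block,
  and among the canonical blocks it fails only for the \<open>1 \<times> 1\<close> zero matrix.\<close>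

definition trivial_common_kernel :: "'a :: comm_ring_1 mat \<Rightarrow> bool" where
  "trivial_common_kernel A \<longleftrightarrow>
     (\<forall>v \<in> carrier_vec (dim_col A).
        A *\<^sub>v v = 0\<^sub>v (dim_row A) \<longrightarrow> transpose_mat A *\<^sub>v v = 0\<^sub>v (dim_col A) \<longrightarrow> v = 0\<^sub>v (dim_col A))"

lemma trivial_common_kernel:
  assumes "A \<in> carrier_mat n n"
  shows "trivial_common_kernel A \<longleftrightarrow>
    (\<forall>v \<in> carrier_vec n. A *\<^sub>v v = 0\<^sub>v n \<longrightarrow> transpose_mat A *\<^sub>v v = 0\<^sub>v n \<longrightarrow> v = 0\<^sub>v n)"
  using assms by (simp add: trivial_common_kernel_def)

section \<open>Invertible matrices, kernels and the congruence action\<close>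

lemma invertible_mat_if_trivial_kernel:
  fixes X :: "'a :: field mat"
  assumes X: "X \<in> carrier_mat n n"
    and "\<And>v. v \<in> carrier_vec n \<Longrightarrow> X *\<^sub>v v = 0\<^sub>v n \<Longrightarrow> v = 0\<^sub>v n"
  shows "invertible_mat X"
proof -
  have "det X \<noteq> 0" using det_0_iff_vec_prod_zero_field[OF X] assms(2) by blast
  \<comment> \<open>The \<open>()\<close> is a dummy value for the record extension of
    \<open>ring_mat\<close>.\<close>
  from det_non_zero_imp_unit[OF X this, of "()"] obtain B where
    "B \<in> carrier_mat n n" "X * B = 1\<^sub>m n" "B * X = 1\<^sub>m n"
    unfolding Units_def ring_mat_def by auto
  then show ?thesis using X unfolding invertible_mat_def inverts_mat_def by auto
qed

lemma invertible_mat_inverse: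
  assumes "invertible_mat P" "P \<in> carrier_mat n n"
  obtains Q where "Q \<in> carrier_mat n n" "P * Q = 1\<^sub>m n" "Q * P = 1\<^sub>m n"
proof -
  from assms obtain Q where Q: "P * Q = 1\<^sub>m n" "Q * P = 1\<^sub>m (dim_row Q)"
    unfolding invertible_mat_def inverts_mat_def by auto
  \<comment> \<open>\<open>invertible_mat\<close> leaves the size of the inverse open; comparing
    column counts in the two product identities fixes it.\<close>
  have "dim_col Q = n" using arg_cong[OF Q(1), of dim_col] by simp
  moreover have "dim_row Q = n" using arg_cong[OF Q(2), of dim_col] assms(2) by simp
  ultimately show ?thesis using Q that by (metis carrier_matI)
qed

lemma congruence_mult_vec:
  fixes A :: "'a :: comm_ring_1 mat"
  assumes "A \<in> carrier_mat n n" "X \<in> carrier_mat n n" "v \<in> carrier_vec n"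
  shows "(transpose_mat X * A * X) *\<^sub>v v = transpose_mat X *\<^sub>v (A *\<^sub>v (X *\<^sub>v v))"
  using assms by (simp add: assoc_mult_mat_vec[of _ n n _ n])

lemma transpose_congruence:
  fixes A :: "'a :: comm_ring_1 mat"
  assumes "A \<in> carrier_mat n n" "X \<in> carrier_mat n n"
  shows "transpose_mat (transpose_mat X * A * X) = transpose_mat X * transpose_mat A * X"
  using assms by (simp add: transpose_mult[of _ n n _ n] assoc_mult_mat[of _ n n _ n _ n])

lemma mult_zero_vec:
  fixes A :: "'a :: comm_ring_1 mat"
  assumes "A \<in> carrier_mat m n"
  shows "A *\<^sub>v 0\<^sub>v n = 0\<^sub>v m"
  using assms by (intro eq_vecI) auto

section \<open>Singular solutions and the common kernel\<close>

lemma Sol_is_group_iff: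
  assumes A: "A \<in> carrier_mat n n"
  shows "Sol_is_group A \<longleftrightarrow> trivial_common_kernel A"
proof
  assume triv: "trivial_common_kernel A"
  show "Sol_is_group A" unfolding Sol_is_group_def
  proof
    fix X assume "X \<in> Sol A"
    then have X: "X \<in> carrier_mat n n" and eq: "transpose_mat X * A * X = A"
      using A by (auto simp: Sol_def)
    show "invertible_mat X"
    proof (rule invertible_mat_if_trivial_kernel[OF X])
      fix v assume v: "v \<in> carrier_vec n" and Xv: "X *\<^sub>v v = 0\<^sub>v n"
      have "A *\<^sub>v v = 0\<^sub>v n"
        using congruence_mult_vec[OF A X v] A X by (simp add: eq Xv mult_zero_vec[of _ n n])
      \<comment> \<open>Transposing the equation shows that \<open>X\<close> solves it for the
        transpose of \<open>A\<close> too, so the same argument applies.\<close>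
      moreover have "transpose_mat A *\<^sub>v v = 0\<^sub>v n"
        using congruence_mult_vec[of "transpose_mat A" n X v] transpose_congruence[OF A X] A X v
        by (simp add: eq Xv mult_zero_vec[of _ n n])
      ultimately show "v = 0\<^sub>v n" using triv v by (simp add: trivial_common_kernel[OF A])
    qed
  qed
next
  assume group: "Sol_is_group A"
  show "trivial_common_kernel A" unfolding trivial_common_kernel[OF A]
  proof (intro ballI impI, rule ccontr)
    fix v assume v: "v \<in> carrier_vec n" and Av: "A *\<^sub>v v = 0\<^sub>v n"
      and Atv: "transpose_mat A *\<^sub>v v = 0\<^sub>v n" and "v \<noteq> 0\<^sub>v n"
    then obtain k where k: "k < n" "v $ k \<noteq> 0" by (auto simp: vec_eq_iff)
    \<comment> \<open>\<open>N\<close> is the rank-one projection \<open>v e_k^T / v_k\<close> onto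
      the line of \<open>v\<close>, so \<open>X = 1 - N\<close> kills \<open>v\<close>.\<close>
    define N where "N = mat n n (\<lambda>(i, j). if j = k then v $ i / v $ k else 0)"
    define X where "X = 1\<^sub>m n - N"
    have N: "N \<in> carrier_mat n n" by (simp add: N_def)
    have X: "X \<in> carrier_mat n n" unfolding X_def by (rule minus_carrier_mat[OF N])
    \<comment> \<open>Every column of \<open>N\<close> is a multiple of \<open>v\<close>. This is
      needed for \<open>A\<close> and for its transpose.\<close>
    have kernel_imp_mult_0: "B * N = 0\<^sub>m n n" if B: "B \<in> carrier_mat n n" and "B *\<^sub>v v = 0\<^sub>v n" for B
    proof (rule eq_matI)
      fix i j assume "i < dim_row (0\<^sub>m n n :: complex mat)" "j < dim_col (0\<^sub>m n n :: complex mat)"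
      then have ij: "i < n" "j < n" by auto
      have "col N j = (if j = k then inverse (v $ k) \<cdot>\<^sub>v v else 0\<^sub>v n)"
        using ij v by (intro eq_vecI) (auto simp: N_def divide_inverse)
      moreover have "row B i \<bullet> v = 0" using arg_cong[OF that(2), of "\<lambda>w. w $ i"] ij B by simp
      ultimately show "(B * N) $$ (i, j) = 0\<^sub>m n n $$ (i, j)"
        using ij B N v by (auto simp: scalar_prod_smult_right)
    qed (use B N in auto)
    have minus_0: "B - 0\<^sub>m n n = B" if "B \<in> carrier_mat n n" for B :: "complex mat"
      using that by (intro eq_matI) auto
    have "transpose_mat N * A = transpose_mat (transpose_mat A * N)"
      using A N by (simp add: transpose_mult[of _ n n _ n])
    also have "\<dots> = 0\<^sub>m n n" using kernel_imp_mult_0[of "transpose_mat A"] A Atv by simp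
    finally have NA: "transpose_mat N * A = 0\<^sub>m n n" .
    \<comment> \<open>Only the right factor \<open>X\<close> is expanded here, and
      \<open>A N = 0\<close> removes its correction term; the left factor is then treated with
      \<open>N^T A = 0\<close>.\<close>
    have "transpose_mat X * A * X = transpose_mat X * A * 1\<^sub>m n - transpose_mat X * (A * N)"
      using A N X by (subst (2) X_def) (simp add: mult_minus_distrib_mat[of _ n n _ n] assoc_mult_mat[of _ n n _ n _ n])
    also have "\<dots> = transpose_mat X * A"
      using A X kernel_imp_mult_0[OF A Av] by (simp add: minus_0)
    also have "\<dots> = (1\<^sub>m n - transpose_mat N) * A"
      by (simp add: X_def transpose_minus[OF one_carrier_mat N])
    also have "\<dots> = A" using A N NA by (simp add: minus_0 minus_mult_distrib_mat[of _ n n _ _ n])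
    finally have "X \<in> Sol A" using A X by (auto simp: Sol_def)
    then have "invertible_mat X" using group by (auto simp: Sol_is_group_def)
    then obtain Q where Q: "Q \<in> carrier_mat n n" "Q * X = 1\<^sub>m n"
      using X by (elim invertible_mat_inverse)
    have "N *\<^sub>v v = v"
    proof (rule eq_vecI)
      fix i assume i: "i < dim_vec v"
      have "(N *\<^sub>v v) $ i = (\<Sum>j<n. (if j = k then v $ i / v $ k else 0) * v $ j)"
        using i v by (simp add: N_def scalar_prod_def atLeast0LessThan)
      also have "\<dots> = (\<Sum>j<n. if j = k then v $ i else 0)" using k by (intro sum.cong) auto
      also have "\<dots> = v $ i" using k by simp
      finally show "(N *\<^sub>v v) $ i = v $ i" .
    qed (use N v in auto)
    then have "X *\<^sub>v v = 0\<^sub>v n"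
      using v N by (simp add: X_def minus_mult_distrib_mat_vec[of _ n n])
    then have "(Q * X) *\<^sub>v v = 0\<^sub>v n"
      using Q(1) X v by (simp add: mult_zero_vec[of _ n n] assoc_mult_mat_vec[of _ n n _ n])
    then show False using Q v \<open>v \<noteq> 0\<^sub>v n\<close> by simp
  qed
qed

section \<open>Congruence and direct sums\<close>

text \<open>Transposition turns \<open>P^T A P\<close> into \<open>P^T A^T P\<close>, and the
  injective left factor \<open>P^T\<close> cancels from both kernel equations. Hence
  \<open>v\<close> lies in the new common kernel iff \<open>P v\<close> lies in the old one.\<close>

lemma trivial_common_kernel_congruent:
  fixes A :: "'a :: comm_ring_1 mat"
  assumes A: "A \<in> carrier_mat n n" and P: "P \<in> carrier_mat n n" "invertible_mat P"
  shows "trivial_common_kernel (transpose_mat P * A * P) \<longleftrightarrow> trivial_common_kernel A"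
proof -
  obtain Q where Q: "Q \<in> carrier_mat n n" "P * Q = 1\<^sub>m n" "Q * P = 1\<^sub>m n"
    using P by (elim invertible_mat_inverse)
  have QtPt: "transpose_mat Q * transpose_mat P = 1\<^sub>m n"
    using transpose_mult[OF P(1) Q(1)] Q(2) by simp
  have P_inj: "P *\<^sub>v v = 0\<^sub>v n \<longleftrightarrow> v = 0\<^sub>v n" if "v \<in> carrier_vec n" for v
    using that P Q assoc_mult_mat_vec[OF Q(1) P(1) that]
    by (auto simp: mult_zero_vec[of _ n n])
  have Pt_inj: "transpose_mat P *\<^sub>v v = 0\<^sub>v n \<longleftrightarrow> v = 0\<^sub>v n" if "v \<in> carrier_vec n" for v
    using that P Q QtPt assoc_mult_mat_vec[of "transpose_mat Q" n n "transpose_mat P" n v]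
    by (auto simp: mult_zero_vec[of _ n n])
  have B: "transpose_mat P * A * P \<in> carrier_mat n n" using A P by simp
  have kernel: "(transpose_mat P * M * P) *\<^sub>v v = 0\<^sub>v n \<longleftrightarrow> M *\<^sub>v (P *\<^sub>v v) = 0\<^sub>v n"
    if "M \<in> carrier_mat n n" "v \<in> carrier_vec n" for M v
    unfolding congruence_mult_vec[OF that(1) P(1) that(2)] using that P by (simp add: Pt_inj)
  have "trivial_common_kernel (transpose_mat P * A * P) \<longleftrightarrow>
    (\<forall>v \<in> carrier_vec n. A *\<^sub>v (P *\<^sub>v v) = 0\<^sub>v n \<longrightarrow>
       transpose_mat A *\<^sub>v (P *\<^sub>v v) = 0\<^sub>v n \<longrightarrow> P *\<^sub>v v = 0\<^sub>v n)"
    unfolding trivial_common_kernel[OF B] transpose_congruence[OF A P(1)]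
    using A by (simp add: kernel P_inj)
  also have "\<dots> \<longleftrightarrow> (\<forall>w \<in> (*\<^sub>v) P ` carrier_vec n. A *\<^sub>v w = 0\<^sub>v n \<longrightarrow>
       transpose_mat A *\<^sub>v w = 0\<^sub>v n \<longrightarrow> w = 0\<^sub>v n)" by simp
  \<comment> \<open>Surjectivity of \<open>P\<close> lets the quantifier range over all vectors
    again.\<close>
  also have "(*\<^sub>v) P ` carrier_vec n = carrier_vec n"
  proof
    show "carrier_vec n \<subseteq> (*\<^sub>v) P ` carrier_vec n"
    proof
      fix w :: "'a vec" assume w: "w \<in> carrier_vec n"
      have "w = P *\<^sub>v (Q *\<^sub>v w)" using assoc_mult_mat_vec[OF P(1) Q(1) w] Q w by simp
      then show "w \<in> (*\<^sub>v) P ` carrier_vec n"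
        using Q(1) w by (metis imageI mult_mat_vec_carrier)
    qed
  qed (use P in auto)
  finally show ?thesis by (simp add: trivial_common_kernel[OF A])
qed

lemma zero_vec_append: "0\<^sub>v n @\<^sub>v 0\<^sub>v m = (0\<^sub>v (n + m) :: 'a :: zero vec)"
  by (intro eq_vecI) auto

lemma append_vec_eq_zero_iff:
  assumes "a \<in> carrier_vec n" "d \<in> carrier_vec m"
  shows "a @\<^sub>v d = 0\<^sub>v (n + m) \<longleftrightarrow> a = 0\<^sub>v n \<and> d = 0\<^sub>v m"
  using append_vec_eq[OF assms(1) zero_carrier_vec] by (simp flip: zero_vec_append)

lemma ball_carrier_vec_append:
  "(\<forall>v \<in> carrier_vec (n + m). \<phi> v) \<longleftrightarrow>
     (\<forall>a \<in> carrier_vec n. \<forall>d \<in> carrier_vec m. \<phi> (a @\<^sub>v d))"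
  by (metis append_carrier_vec vec_first_carrier vec_first_last_append vec_last_carrier)

text \<open>A block diagonal matrix and its transpose act on the two components separately, so the
  common kernel is the product of those of the blocks.\<close>

lemma trivial_common_kernel_direct_sum:
  fixes A :: "'a :: comm_ring_1 mat"
  assumes A: "A \<in> carrier_mat n n" and D: "D \<in> carrier_mat m m"
  shows "trivial_common_kernel (four_block_mat A (0\<^sub>m n m) (0\<^sub>m m n) D) \<longleftrightarrow>
    trivial_common_kernel A \<and> trivial_common_kernel D"
proof -
  have carrier: "four_block_mat A (0\<^sub>m n m) (0\<^sub>m m n) D \<in> carrier_mat (n + m) (n + m)"
    using A D by simp
  have transpose: "transpose_mat (four_block_mat A (0\<^sub>m n m) (0\<^sub>m m n) D) =
      four_block_mat (transpose_mat A) (0\<^sub>m n m) (0\<^sub>m m n) (transpose_mat D)"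
    using A D by (simp add: transpose_four_block_mat[of _ n n _ m _ m])
  have "trivial_common_kernel (four_block_mat A (0\<^sub>m n m) (0\<^sub>m m n) D) \<longleftrightarrow>
    (\<forall>a \<in> carrier_vec n. \<forall>d \<in> carrier_vec m.
       A *\<^sub>v a = 0\<^sub>v n \<and> D *\<^sub>v d = 0\<^sub>v m \<longrightarrow>
       transpose_mat A *\<^sub>v a = 0\<^sub>v n \<and> transpose_mat D *\<^sub>v d = 0\<^sub>v m \<longrightarrow>
       a = 0\<^sub>v n \<and> d = 0\<^sub>v m)"
    unfolding trivial_common_kernel[OF carrier] transpose ball_carrier_vec_append
    using A D by (simp add: mult_mat_vec_split[of _ n _ m] append_vec_eq_zero_iff)
  \<comment> \<open>To isolate one block, the component in the other is taken to be zero.\<close>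
  also have "\<dots> \<longleftrightarrow> trivial_common_kernel A \<and> trivial_common_kernel D"
    unfolding trivial_common_kernel[OF A] trivial_common_kernel[OF D]
    using A D by (safe; metis mult_zero_vec transpose_carrier_mat zero_carrier_vec)
  finally show ?thesis .
qed

lemma trivial_common_kernel_diag_block_mat:
  fixes Ms :: "'a :: comm_ring_1 mat list"
  assumes "\<forall>M \<in> set Ms. square_mat M"
  shows "trivial_common_kernel (diag_block_mat Ms) \<longleftrightarrow> (\<forall>M \<in> set Ms. trivial_common_kernel M)"
  using assms
proof (induction Ms)
  case Nil
  \<comment> \<open>The empty direct sum is the 0 x 0 matrix, and its only vector is zero.\<close>
  then show ?case by (auto simp: trivial_common_kernel_def)
next
  case (Cons M Ms)
  obtain n m where M: "M \<in> carrier_mat n n" and D: "diag_block_mat Ms \<in> carrier_mat m m"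
    using diag_block_mat_square[of Ms] Cons.prems by auto
  then have "diag_block_mat (M # Ms) = four_block_mat M (0\<^sub>m n m) (0\<^sub>m m n) (diag_block_mat Ms)"
    by (simp add: Let_def)
  then show ?case
    using Cons trivial_common_kernel_direct_sum[OF M D] by simp
qed

section \<open>Criteria for the shapes of the canonical blocks\<close>

text \<open>The matrix sends \<open>(a, d)\<close> to \<open>(P d, Q a)\<close>, and its transpose
  has second component \<open>P^T a\<close>. The conditions on \<open>a\<close> are used jointly
  with type A in view: there, for \<open>r >= 1\<close>, neither \<open>Q\<close> nor
  \<open>P^T\<close> is injective alone.\<close>

lemma trivial_common_kernel_off_diagonal:
  fixes P :: "'a :: comm_ring_1 mat"
  assumes P: "P \<in> carrier_mat n m" and Q: "Q \<in> carrier_mat m n"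
    and P_inj: "\<And>d. d \<in> carrier_vec m \<Longrightarrow> P *\<^sub>v d = 0\<^sub>v n \<Longrightarrow> d = 0\<^sub>v m"
    and Q_inj: "\<And>a. a \<in> carrier_vec n \<Longrightarrow> Q *\<^sub>v a = 0\<^sub>v m \<Longrightarrow> transpose_mat P *\<^sub>v a = 0\<^sub>v m
      \<Longrightarrow> a = 0\<^sub>v n"
  shows "trivial_common_kernel (four_block_mat (0\<^sub>m n n) P Q (0\<^sub>m m m))"
proof -
  have carrier: "four_block_mat (0\<^sub>m n n) P Q (0\<^sub>m m m) \<in> carrier_mat (n + m) (n + m)"
    using P Q by simp
  have transpose: "transpose_mat (four_block_mat (0\<^sub>m n n) P Q (0\<^sub>m m m)) =
      four_block_mat (0\<^sub>m n n) (transpose_mat Q) (transpose_mat P) (0\<^sub>m m m)"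
    using P Q by (simp add: transpose_four_block_mat[of _ n n _ m _ m])
  have mult: "four_block_mat (0\<^sub>m n n) R S (0\<^sub>m m m) *\<^sub>v (a @\<^sub>v d) = (R *\<^sub>v d) @\<^sub>v (S *\<^sub>v a)"
    if "R \<in> carrier_mat n m" "S \<in> carrier_mat m n" "a \<in> carrier_vec n" "d \<in> carrier_vec m"
    for R S :: "'a mat" and a d
    using that by (subst four_block_mat_mult_vec[of _ n n _ m _ m]) auto
  show ?thesis
    unfolding trivial_common_kernel[OF carrier] transpose ball_carrier_vec_append
  proof (intro ballI impI)
    fix a d :: "'a vec"
    assume a: "a \<in> carrier_vec n" and d: "d \<in> carrier_vec m"
      and "four_block_mat (0\<^sub>m n n) P Q (0\<^sub>m m m) *\<^sub>v (a @\<^sub>v d) = 0\<^sub>v (n + m)"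
      and "four_block_mat (0\<^sub>m n n) (transpose_mat Q) (transpose_mat P) (0\<^sub>m m m) *\<^sub>v (a @\<^sub>v d) = 0\<^sub>v (n + m)"
    then have "P *\<^sub>v d = 0\<^sub>v n" "Q *\<^sub>v a = 0\<^sub>v m" "transpose_mat P *\<^sub>v a = 0\<^sub>v m"
      using P Q by (simp_all add: mult append_vec_eq_zero_iff)
    then have "a = 0\<^sub>v n" "d = 0\<^sub>v m" using P_inj Q_inj a d by blast+
    then show "a @\<^sub>v d = 0\<^sub>v (n + m)" by (simp add: zero_vec_append)
  qed
qed

text \<open>Substitution from the top row down: row \<open>i\<close> involves only the coordinates
  from \<open>n - 1 - i\<close> on, and the later ones are already known to vanish. In an integral
  domain the nonzero antidiagonal entry cancels.\<close>

lemma anti_triangular_mat_inj: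
  fixes M :: "'a :: idom mat"
  assumes M: "M \<in> carrier_mat n n"
    and above: "\<And>i j. i + j + 1 < n \<Longrightarrow> M $$ (i, j) = 0"
    and antidiagonal: "\<And>i j. i + j + 1 = n \<Longrightarrow> M $$ (i, j) \<noteq> 0"
    and v: "v \<in> carrier_vec n" and Mv: "M *\<^sub>v v = 0\<^sub>v n"
  shows "v = 0\<^sub>v n"
proof -
  have zero: "v $ (n - Suc i) = 0" if "i < n" for i
    using that
  proof (induction i rule: less_induct)
    case (less i)
    have other: "M $$ (i, j) * v $ j = 0" if "j < n" "j \<noteq> n - Suc i" for j
    proof (cases "i + j + 1 < n")
      case False
      \<comment> \<open>Here \<open>j\<close> lies beyond the antidiagonal, so \<open>v $ j\<close>
        was settled by the earlier row \<open>n - Suc j\<close>.\<close>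
      with that less.prems have "n - Suc j < i" "n - Suc (n - Suc j) = j" by auto
      with less.IH[of "n - Suc j"] less.prems show ?thesis by simp
    qed (simp add: above)
    have "0 = (M *\<^sub>v v) $ i" using Mv less.prems by simp
    also have "\<dots> = (\<Sum>j<n. M $$ (i, j) * v $ j)"
      using M v less.prems by (simp add: scalar_prod_def atLeast0LessThan)
    also have "\<dots> = (\<Sum>j\<in>{n - Suc i}. M $$ (i, j) * v $ j)"
      using other less.prems by (intro sum.mono_neutral_right) auto
    finally show ?case using antidiagonal[of i "n - Suc i"] less.prems by simp
  qed
  have "v $ j = 0" if "j < n" for j
    using that zero[of "n - Suc j"] by (simp add: Suc_diff_Suc)
  with v show ?thesis by (intro eq_vecI) auto
qed

lemma trivial_common_kernel_anti_triangular:
  fixes M :: "'a :: idom mat"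
  assumes "M \<in> carrier_mat n n"
    and "\<And>i j. i + j + 1 < n \<Longrightarrow> M $$ (i, j) = 0"
    and "\<And>i j. i + j + 1 = n \<Longrightarrow> M $$ (i, j) \<noteq> 0"
  shows "trivial_common_kernel M"
  unfolding trivial_common_kernel[OF assms(1)] using anti_triangular_mat_inj[OF assms] by blast

text \<open>The index conditions are symmetric in \<open>i\<close> and \<open>j\<close>, so
  \<open>P\<close> and \<open>P^T\<close> are both injective: \<open>P\<close> forces
  \<open>d = 0\<close> and \<open>P^T\<close> forces \<open>a = 0\<close>. The conditions sit on the
  upper right block because the lower left one can be singular, as \<open>I_mat r 0\<close> is in
  \<open>B_type r 0\<close>.\<close>

lemma trivial_common_kernel_off_diagonal_anti_triangular:
  fixes P :: "'a :: idom mat"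
  assumes P: "P \<in> carrier_mat r r" and Q: "Q \<in> carrier_mat r r"
    and "\<And>i j. i + j + 1 < r \<Longrightarrow> P $$ (i, j) = 0"
    and "\<And>i j. i + j + 1 = r \<Longrightarrow> P $$ (i, j) \<noteq> 0"
  shows "trivial_common_kernel (four_block_mat (0\<^sub>m r r) P Q (0\<^sub>m r r))"
proof (rule trivial_common_kernel_off_diagonal[OF P Q])
  fix a assume "a \<in> carrier_vec r" "transpose_mat P *\<^sub>v a = 0\<^sub>v r"
  then show "a = 0\<^sub>v r"
  proof (rule anti_triangular_mat_inj[rotated 3])
    show "transpose_mat P $$ (i, j) = 0" if "i + j + 1 < r" for i j
      using P assms(3)[of j i] that by (simp add: add.commute)
    show "transpose_mat P $$ (i, j) \<noteq> 0" if "i + j + 1 = r" for i j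
      using P assms(4)[of j i] that by (simp add: add.commute)
  qed (use P in simp)
qed (use anti_triangular_mat_inj assms in blast)

section \<open>The common kernels of the six types\<close>

text \<open>\<open>P\<close> appends a zero coordinate, \<open>P^T\<close> drops the last coordinate
  and \<open>Q\<close> drops the first. For \<open>r >= 1\<close> the two truncations together see
  every coordinate of a vector of length \<open>r + 1\<close>; for \<open>r = 0\<close> they see
  none.\<close>

lemma trivial_common_kernel_A_type: "trivial_common_kernel (A_type r) \<longleftrightarrow> r \<noteq> 0"
proof (cases "r = 0")
  case True
  have "(unit_vec 1 0 :: complex vec) \<noteq> 0\<^sub>v 1" by (auto simp: vec_eq_iff)
  moreover have "(0\<^sub>m 1 1 :: complex mat) *\<^sub>v unit_vec 1 0 = 0\<^sub>v 1" by (intro eq_vecI) auto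
  ultimately have "\<not> trivial_common_kernel (0\<^sub>m 1 1 :: complex mat)"
    by (metis trivial_common_kernel zero_transpose_mat unit_vec_carrier zero_carrier_mat)
  then show ?thesis using True by (simp only: A_type_0) simp
next
  case False
  define P :: "complex mat" where "P = mat (r + 1) r (\<lambda>(i, j). if i = j then 1 else 0)"
  define Q :: "complex mat" where "Q = mat r (r + 1) (\<lambda>(i, j). if j = i + 1 then 1 else 0)"
  have delta: "(\<Sum>j<n. (if j = k then 1 else 0) * f j) = f k" "(\<Sum>j<n. (if k = j then 1 else 0) * f j) = f k"
    if "k < n" for k n :: nat and f :: "nat \<Rightarrow> complex"
    using that by (simp_all add: if_distrib[of "\<lambda>x. x * _"] cong: if_cong)
  have P: "(P *\<^sub>v d) $ i = d $ i" if "d \<in> carrier_vec r" "i < r" for d i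
    using that by (simp add: P_def scalar_prod_def atLeast0LessThan delta)
  have Pt: "(transpose_mat P *\<^sub>v a) $ i = a $ i" if "a \<in> carrier_vec (r + 1)" "i < r" for a i
    using that by (simp add: P_def scalar_prod_def atLeast0LessThan delta del: sum.lessThan_Suc)
  have Q: "(Q *\<^sub>v a) $ i = a $ (i + 1)" if "a \<in> carrier_vec (r + 1)" "i < r" for a i
    using that by (simp add: Q_def scalar_prod_def atLeast0LessThan delta del: sum.lessThan_Suc)
  have "trivial_common_kernel (four_block_mat (0\<^sub>m (r + 1) (r + 1)) P Q (0\<^sub>m r r))"
  proof (rule trivial_common_kernel_off_diagonal)
    fix d assume d: "d \<in> carrier_vec r" "P *\<^sub>v d = 0\<^sub>v (r + 1)"
    show "d = 0\<^sub>v r" using d P[OF d(1)] by (intro eq_vecI) auto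
  next
    fix a assume a: "a \<in> carrier_vec (r + 1)" "Q *\<^sub>v a = 0\<^sub>v r" "transpose_mat P *\<^sub>v a = 0\<^sub>v r"
    show "a = 0\<^sub>v (r + 1)"
    proof (rule eq_vecI)
      fix i assume "i < dim_vec (0\<^sub>v (r + 1) :: complex vec)"
      \<comment> \<open>The last coordinate, \<open>i = r\<close>, is read off from row
        \<open>r - 1\<close> of \<open>Q\<close>, which exists because \<open>r\<close> is
        nonzero.\<close>
      then consider "i < r" | "i = (r - 1) + 1" "r - 1 < r" using False by fastforce
      then show "a $ i = 0\<^sub>v (r + 1) $ i"
        using a Pt[OF a(1), of i] Q[OF a(1), of "r - 1"] by cases auto
    qed (use a in auto)
  qed (simp_all add: P_def Q_def)
  then show ?thesis using False by (simp add: A_type_def P_def Q_def)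
qed

lemma canonical_block_square: "canonical_block M \<Longrightarrow> square_mat M"
  by (induction rule: canonical_block.induct)
    (auto simp: A_type_def B_type_def C_type_def D_type_def E_type_def F_type_def J_mat_def I_mat_def)

text \<open>Types C and E are anti-triangular as a whole; B, D and F have an anti-triangular upper
  right block. A trivial common kernel already separates these from \<open>A_type 0\<close>, while
  within type A the size \<open>2 * r + 1\<close> determines \<open>r\<close>.\<close>

lemma canonical_block_trivial_common_kernel:
  assumes "canonical_block M"
  shows "trivial_common_kernel M \<longleftrightarrow> M \<noteq> A_type 0"
  using assms
proof cases
  case (A r)
  have "r = 0" if "A_type r = A_type 0"
    using arg_cong[OF that, of dim_row] by (simp add: A_type_def)
  then show ?thesis using A trivial_common_kernel_A_type by metis
next
  case (C r)
  have "trivial_common_kernel (C_type r)"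
    by (rule trivial_common_kernel_anti_triangular[of _ "2 * r + 1"]) (auto simp: C_type_def)
  then show ?thesis using C trivial_common_kernel_A_type by metis
next
  case (E r)
  have "trivial_common_kernel (E_type r)"
    by (rule trivial_common_kernel_anti_triangular[of _ "2 * r"]) (auto simp: E_type_def)
  then show ?thesis using E trivial_common_kernel_A_type by metis
next
  case (B r c)
  have "trivial_common_kernel (B_type r c)"
    unfolding B_type_def
    by (rule trivial_common_kernel_off_diagonal_anti_triangular) (auto simp: J_mat_def I_mat_def)
  then show ?thesis using B trivial_common_kernel_A_type by metis
next
  case (D r)
  have "trivial_common_kernel (D_type r)"
    unfolding D_type_def
    by (rule trivial_common_kernel_off_diagonal_anti_triangular) (auto simp: J_mat_def)
  then show ?thesis using D trivial_common_kernel_A_type by metis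
next
  case (F r)
  have "trivial_common_kernel (F_type r)"
    unfolding F_type_def
    by (rule trivial_common_kernel_off_diagonal_anti_triangular) (auto simp: I_mat_def)
  then show ?thesis using F trivial_common_kernel_A_type by metis
qed

theorem theorem3p11:
  fixes n :: nat and A :: "complex mat" and Ms :: "complex mat list"
  assumes "A \<in> carrier_mat n n"
    and "\<forall>M \<in> set Ms. canonical_block M"
    and "congruent_mat A (diag_block_mat Ms)"
  shows "Sol_is_group A \<longleftrightarrow> A_type 0 \<notin> set Ms"
proof -
  obtain P where P: "P \<in> carrier_mat n n" "invertible_mat P"
      "transpose_mat P * A * P = diag_block_mat Ms"
    using assms(1,3) by (auto simp: congruent_mat_def)
  have "Sol_is_group A \<longleftrightarrow> trivial_common_kernel (diag_block_mat Ms)"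
    using Sol_is_group_iff[OF assms(1)] trivial_common_kernel_congruent[OF assms(1) P(1,2)]
    by (simp add: P(3))
  also have "\<dots> \<longleftrightarrow> (\<forall>M \<in> set Ms. trivial_common_kernel M)"
    using assms(2) canonical_block_square by (intro trivial_common_kernel_diag_block_mat) blast
  also have "\<dots> \<longleftrightarrow> A_type 0 \<notin> set Ms"
    using assms(2) canonical_block_trivial_common_kernel by blast
  finally show ?thesis .
qed

end
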